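(* Let $n\ge 1$ and $k\ge 2$ be integers and put $r=k-1$. There is a bijection between $\mathfrak{M}_{n,k}$ and the set of Kekul\'e structures (perfect matchings) of the benzenoid graph $G_{n,r}$. In particular, the two sets have the same cardinality.
   Context: A $2\times n$ matrix $A=(a_{i,j})$ is weakly increasing if $a_{i,j}\le a_{i',j'}$ whenever $i\le i'$ and $j\le j'$. $\mathfrak{M}_{n,k}$ denotes the set of $2\times n$ weakly increasing matrices with integer entries in $\{1,\dots,k\}$. Benzenoid graph: tile the plane by congruent regular hexagons of width $1$, each having two vertical edges (pointed top and bottom), arranged in horizontal rows with consecutive rows offset by half a width. Index the cells by pairs $(u,i)\in\mathbb{Z}^2$ ($i$ = row, increasing downward), the cell $(u,i)$ having center with horizontal coordinate $u-i/2$; thus cell $(u,i)$ shares an edge with $(u\pm1,i)$, with $(u,i+1)$ and $(u+1,i+1)$ below it, and with $(u-1,i-1)$ and $(u,i-1)$ above it. For integers $n\ge1$, $r\ge1$, let $O_{n,r}$ be the set of cells $(u,i)$ with $0\le i\le r$ and $\max(0,i-r+1)\le u\le \min(n-1+i,\,n)$ (so row $0$ has $n$ cells, rows $1,\dots,r-1$ have $n+1$ cells, row $r$ has $n$ cells; this is the hexagon-shaped benzenoid with sides of $n,2,r,n,2,r$ hexagons, denoted $O\{n,2,r\}$). $G_{n,r}$ is the plane graph whose vertices and edges are the vertices and edges of the hexagons in $O_{n,r}$. A Kekul\'e structure of $G_{n,r}$ is a perfect matching of $G_{n,r}$. *)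

theory Defs
  imports Main "HOL-Library.FuncSet"
begin

definition weakly_increasing_mats :: "nat \<Rightarrow> nat \<Rightarrow> (nat \<times> nat \<Rightarrow> nat) set" where
  "weakly_increasing_mats n k =
     {A \<in> ({1,2} \<times> {1..n}) \<rightarrow>\<^sub>E {1..k}.
        \<forall>i j i' j'. (i, j) \<in> {1,2} \<times> {1..n} \<longrightarrow> (i', j') \<in> {1,2} \<times> {1..n}
           \<longrightarrow> i \<le> i' \<longrightarrow> j \<le> j' \<longrightarrow> A (i, j) \<le> A (i', j')}"

text \<open>Cells (u,i) of the hexagonal tiling, row i increasing downward.
  Vertices are given integer coordinates (X,Y): X in units of half the hexagon
  width, Y (downward) in units of 1/(2 sqrt 3). The cell (u,i) has center
  (2u - i, 3i) and its six vertices are listed cyclically.\<close>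

definition hex_vertices :: "int \<times> int \<Rightarrow> (int \<times> int) list" where
  "hex_vertices c = (case c of (u, i) \<Rightarrow>
     [(2*u - i, 3*i - 2), (2*u - i + 1, 3*i - 1), (2*u - i + 1, 3*i + 1),
      (2*u - i, 3*i + 2), (2*u - i - 1, 3*i + 1), (2*u - i - 1, 3*i - 1)])"

definition hex_edges :: "int \<times> int \<Rightarrow> (int \<times> int) set set" where
  "hex_edges c = {{hex_vertices c ! j, hex_vertices c ! ((j + 1) mod 6)} | j. j < 6}"

definition benzenoid_cells :: "nat \<Rightarrow> nat \<Rightarrow> (int \<times> int) set" where
  "benzenoid_cells n r =
     {(u, i). 0 \<le> i \<and> i \<le> int r \<and>
              max 0 (i - int r + 1) \<le> u \<and> u \<le> min (int n - 1 + i) (int n)}"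

definition benz_V :: "nat \<Rightarrow> nat \<Rightarrow> (int \<times> int) set" where
  "benz_V n r = (\<Union>c \<in> benzenoid_cells n r. set (hex_vertices c))"

definition benz_E :: "nat \<Rightarrow> nat \<Rightarrow> (int \<times> int) set set" where
  "benz_E n r = (\<Union>c \<in> benzenoid_cells n r. hex_edges c)"

definition perfect_matchings :: "'a set \<Rightarrow> 'a set set \<Rightarrow> 'a set set set" where
  "perfect_matchings V E = {M. M \<subseteq> E \<and> (\<forall>v \<in> V. \<exists>!e. e \<in> M \<and> v \<in> e)}"

definition kekule_structures :: "nat \<Rightarrow> nat \<Rightarrow> (int \<times> int) set set set" where
  "kekule_structures n r = perfect_matchings (benz_V n r) (benz_E n r)"

end

theory Submission
  imports Defs
begin

text \<open>A Kekule structure is encoded by its height function: the height at position u of row i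
  is the number of vertical edges of the matching in row i up to position u. Matchings
  correspond to the integer functions with fixed boundary values that are monotone in both
  directions and satisfy D (i + 1) (u + 1) \<le> D i u + 1. These take values in {0, 1, 2}, and the
  regions where the height is at least 1 and at least 2 are the regions above thresholds that
  are read off from the second and the first row of a weakly increasing matrix.\<close>

text \<open>Every vertex of the tiling meets three cells and three edges, while vertices on the rim
  of the benzenoid may have degree two. Heights therefore live on all cells of the plane, where one
  rule serves every vertex: the three surrounding heights, suitably ordered, increase weakly by at
  most 1 in total. The two gaps and the slack left to 1 are three numbers in {0, 1} with sum 1, one
  for each edge at the vertex, and the number equal to 1 selects the matched edge; the slack belongs
  to the rising edge. Each inequality has a counterpart for matrices. Growth in i makes a region a
  final segment of rows at every position u, so one number describes it. Growth in u gives monotone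
  matrix rows. The diagonal inequality says that height 2 at (i + 1, u + 1) forces height 1 at (i,
  u), which becomes A (1, j) \<le> A (2, j). For 1 \<le> j \<le> n, height 2 is first reached at
  position j in one of the rows 1, ..., r + 1, and height 1 at position j - 1 in one of the rows 0,
  ..., r: both times r + 1 = k choices.\<close>

text \<open>Peak (i, u) is the top of the cell (u, i) and valley (i, u) its upper left corner.\<close>

definition peak :: "int \<Rightarrow> int \<Rightarrow> int \<times> int" where
  "peak i u = (2*u - i, 3*i - 2)"

definition valley :: "int \<Rightarrow> int \<Rightarrow> int \<times> int" where
  "valley i u = (2*u - i - 1, 3*i - 1)"

text \<open>The falling, rising and vertical edge with index (i, u) are the upper right, upper left
  and left side of the cell (u, i), so each edge of the tiling gets exactly one name. Every edge
  joins a peak to a valley.\<close>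

definition falling_edge :: "int \<Rightarrow> int \<Rightarrow> (int \<times> int) set" where
  "falling_edge i u = {peak i u, valley i (u + 1)}"

definition rising_edge :: "int \<Rightarrow> int \<Rightarrow> (int \<times> int) set" where
  "rising_edge i u = {peak i u, valley i u}"

definition vertical_edge :: "int \<Rightarrow> int \<Rightarrow> (int \<times> int) set" where
  "vertical_edge i u = {peak (i + 1) u, valley i u}"

lemma peak_inject [simp]: "peak i u = peak j w \<longleftrightarrow> i = j \<and> u = w"
  by (auto simp: peak_def)

lemma valley_inject [simp]: "valley i u = valley j w \<longleftrightarrow> i = j \<and> u = w"
  by (auto simp: valley_def)

text \<open>The second coordinate is 1 modulo 3 at a peak and 2 modulo 3 at a valley.\<close>

lemma peak_neq_valley [simp]: "peak i u \<noteq> valley j w" "valley j w \<noteq> peak i u"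
  unfolding peak_def valley_def by (auto, presburger+)

lemmas edge_defs = falling_edge_def rising_edge_def vertical_edge_def

lemma edge_inject [simp]:
  "falling_edge i u = falling_edge j w \<longleftrightarrow> i = j \<and> u = w"
  "rising_edge i u = rising_edge j w \<longleftrightarrow> i = j \<and> u = w"
  "vertical_edge i u = vertical_edge j w \<longleftrightarrow> i = j \<and> u = w"
  by (auto simp: edge_defs doubleton_eq_iff)

lemma edge_distinct [simp]:
  "falling_edge i u \<noteq> rising_edge j w" "rising_edge j w \<noteq> falling_edge i u"
  "falling_edge i u \<noteq> vertical_edge j w" "vertical_edge j w \<noteq> falling_edge i u"
  "rising_edge i u \<noteq> vertical_edge j w" "vertical_edge j w \<noteq> rising_edge i u"
  by (auto simp: edge_defs doubleton_eq_iff)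

lemma peak_in_edge [simp]:
  "peak i u \<in> falling_edge j w \<longleftrightarrow> i = j \<and> u = w"
  "peak i u \<in> rising_edge j w \<longleftrightarrow> i = j \<and> u = w"
  "peak i u \<in> vertical_edge j w \<longleftrightarrow> i = j + 1 \<and> u = w"
  by (auto simp: edge_defs)

lemma valley_in_edge [simp]:
  "valley i u \<in> falling_edge j w \<longleftrightarrow> i = j \<and> u = w + 1"
  "valley i u \<in> rising_edge j w \<longleftrightarrow> i = j \<and> u = w"
  "valley i u \<in> vertical_edge j w \<longleftrightarrow> i = j \<and> u = w"
  by (auto simp: edge_defs)

lemma set_hex_vertices:
  "set (hex_vertices (u, i)) =
     {peak i u, valley i (u + 1), peak (i + 1) (u + 1), valley (i + 1) (u + 1),
      peak (i + 1) u, valley i u}"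
  by (simp add: hex_vertices_def peak_def valley_def algebra_simps)

lemma hex_edges_eq:
  "hex_edges (u, i) =
     {falling_edge i u, vertical_edge i (u + 1), rising_edge (i + 1) (u + 1),
      falling_edge (i + 1) u, vertical_edge i u, rising_edge i u}"
proof -
  have "hex_edges (u, i) =
    (\<lambda>j. {hex_vertices (u, i) ! j, hex_vertices (u, i) ! ((j + 1) mod 6)}) ` {..<6}"
    unfolding hex_edges_def by auto
  also have "{..<6::nat} = {0, 1, 2, 3, 4, 5}"
    by auto
  finally show ?thesis
    by (simp add: hex_vertices_def edge_defs peak_def valley_def algebra_simps insert_commute)
qed

text \<open>Turns "covered exactly once" at a vertex of degree three into a linear equation, so that
  the conditions at neighbouring vertices can be added and subtracted.\<close>

lemma ex1_among_three:
  assumes "a \<noteq> b" "a \<noteq> c" "b \<noteq> c"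
  shows "(\<exists>!x. x \<in> M \<and> (x = a \<or> x = b \<or> x = c)) \<longleftrightarrow>
    of_bool (a \<in> M) + of_bool (b \<in> M) + of_bool (c \<in> M) = (1::int)"
proof -
  have "(\<exists>!x. x \<in> M \<and> (x = a \<or> x = b \<or> x = c)) \<longleftrightarrow>
    (a \<in> M \<and> b \<notin> M \<and> c \<notin> M) \<or> (a \<notin> M \<and> b \<in> M \<and> c \<notin> M) \<or> (a \<notin> M \<and> b \<notin> M \<and> c \<in> M)"
    using assms by blast
  then show ?thesis by auto
qed

lemma threshold_exists:
  fixes Q :: "nat \<Rightarrow> bool"
  assumes "\<And>m. Q (Suc m) \<Longrightarrow> Q m"
  shows "\<exists>a\<le>k. \<forall>m\<in>{1..k}. m \<le> a \<longleftrightarrow> Q m"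
proof (induction k)
  case (Suc k)
  then obtain a where a: "a \<le> k" "\<forall>m\<in>{1..k}. m \<le> a \<longleftrightarrow> Q m"
    by blast
  show ?case
  proof (cases "Q (Suc k)")
    case True
    have "Q m" if "m \<le> Suc k" for m
      using that True by (induction rule: inc_induct) (use assms in auto)
    then show ?thesis by auto
  next
    case False
    with a have "\<forall>m\<in>{1..Suc k}. m \<le> a \<longleftrightarrow> Q m"
      by (auto simp: le_Suc_eq)
    with a show ?thesis by (intro exI[of _ a]) auto
  qed
qed auto

section \<open>The benzenoid and its Kekule structures in coordinates\<close>

locale hexagonal_benzenoid =
  fixes n r :: nat
  assumes n_pos: "n \<ge> 1" and r_pos: "r \<ge> 1"
begin

text \<open>This and the next four predicates use a bounding box; the negated clauses remove
  positions near its upper right and lower left corners.\<close>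

definition is_peak :: "int \<Rightarrow> int \<Rightarrow> bool" where
  "is_peak i u \<longleftrightarrow> 0 \<le> i \<and> i \<le> int r + 1 \<and> 0 \<le> u \<and> u \<le> int n + 1 \<and>
     \<not> (i = 0 \<and> u \<ge> int n) \<and> \<not> (i = 1 \<and> u = int n + 1) \<and> \<not> (i = int r + 1 \<and> u = 0)"

definition is_valley :: "int \<Rightarrow> int \<Rightarrow> bool" where
  "is_valley i u \<longleftrightarrow> 0 \<le> i \<and> i \<le> int r + 1 \<and> 0 \<le> u \<and> u \<le> int n + 1 \<and>
     \<not> (i = 0 \<and> u = int n + 1) \<and> \<not> (i = int r \<and> u = 0) \<and> \<not> (i = int r + 1 \<and> u \<le> 1)"

definition is_falling :: "int \<Rightarrow> int \<Rightarrow> bool" where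
  "is_falling i u \<longleftrightarrow> 0 \<le> i \<and> i \<le> int r + 1 \<and> 0 \<le> u \<and> u \<le> int n \<and>
     \<not> (i = 0 \<and> u = int n) \<and> \<not> (i = int r + 1 \<and> u = 0)"

definition is_rising :: "int \<Rightarrow> int \<Rightarrow> bool" where
  "is_rising i u \<longleftrightarrow> 0 \<le> i \<and> i \<le> int r + 1 \<and> 0 \<le> u \<and> u \<le> int n + 1 \<and>
     \<not> (i = 0 \<and> u \<ge> int n) \<and> \<not> (i = 1 \<and> u = int n + 1) \<and>
     \<not> (i = int r \<and> u = 0) \<and> \<not> (i = int r + 1 \<and> u \<le> 1)"

definition is_vertical :: "int \<Rightarrow> int \<Rightarrow> bool" where
  "is_vertical i u \<longleftrightarrow> 0 \<le> i \<and> i \<le> int r \<and> 0 \<le> u \<and> u \<le> int n + 1 \<and>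
     \<not> (i = 0 \<and> u = int n + 1) \<and> \<not> (i = int r \<and> u = 0)"

text \<open>The region is a parallelogram of r + 1 rows with n + 1 cells each, from which the two
  opposite corner cells (n, 0) and (0, r) are removed.\<close>

lemma cell_iff:
  "(u, i) \<in> benzenoid_cells n r \<longleftrightarrow> 0 \<le> i \<and> i \<le> int r \<and> 0 \<le> u \<and> u \<le> int n \<and>
     \<not> (i = 0 \<and> u = int n) \<and> \<not> (i = int r \<and> u = 0)"
  using n_pos r_pos unfolding benzenoid_cells_def by auto

lemma peak_in_V: "peak i u \<in> benz_V n r \<longleftrightarrow> is_peak i u"
proof -
  have "peak i u \<in> set (hex_vertices (w, j)) \<longleftrightarrow>
      (w = u \<and> j = i) \<or> (w = u \<and> j = i - 1) \<or> (w = u - 1 \<and> j = i - 1)" for w j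
    by (auto simp: set_hex_vertices)
  then have "peak i u \<in> benz_V n r \<longleftrightarrow> (u, i) \<in> benzenoid_cells n r \<or>
      (u, i - 1) \<in> benzenoid_cells n r \<or> (u - 1, i - 1) \<in> benzenoid_cells n r"
    by (simp add: benz_V_def Bex_def split_paired_Ex conj_disj_distribL ex_disj_distrib)
  then show ?thesis
    using n_pos r_pos unfolding cell_iff is_peak_def by (smt (verit) of_nat_1 of_nat_mono)
qed

lemma valley_in_V: "valley i u \<in> benz_V n r \<longleftrightarrow> is_valley i u"
proof -
  have "valley i u \<in> set (hex_vertices (w, j)) \<longleftrightarrow>
      (w = u \<and> j = i) \<or> (w = u - 1 \<and> j = i) \<or> (w = u - 1 \<and> j = i - 1)" for w j
    by (auto simp: set_hex_vertices)
  then have "valley i u \<in> benz_V n r \<longleftrightarrow> (u, i) \<in> benzenoid_cells n r \<or>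
      (u - 1, i) \<in> benzenoid_cells n r \<or> (u - 1, i - 1) \<in> benzenoid_cells n r"
    by (simp add: benz_V_def Bex_def split_paired_Ex conj_disj_distribL ex_disj_distrib)
  then show ?thesis
    using n_pos r_pos unfolding cell_iff is_valley_def by (smt (verit) of_nat_1 of_nat_mono)
qed

lemma falling_in_E: "falling_edge i u \<in> benz_E n r \<longleftrightarrow> is_falling i u"
proof -
  have "falling_edge i u \<in> hex_edges (w, j) \<longleftrightarrow>
      (w = u \<and> j = i) \<or> (w = u \<and> j = i - 1)" for w j
    by (auto simp: hex_edges_eq)
  then have "falling_edge i u \<in> benz_E n r \<longleftrightarrow> (u, i) \<in> benzenoid_cells n r \<or>
      (u, i - 1) \<in> benzenoid_cells n r"
    by (simp add: benz_E_def Bex_def split_paired_Ex conj_disj_distribL ex_disj_distrib)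
  then show ?thesis
    using n_pos r_pos unfolding cell_iff is_falling_def by (smt (verit) of_nat_1 of_nat_mono)
qed

lemma rising_in_E: "rising_edge i u \<in> benz_E n r \<longleftrightarrow> is_rising i u"
proof -
  have "rising_edge i u \<in> hex_edges (w, j) \<longleftrightarrow>
      (w = u \<and> j = i) \<or> (w = u - 1 \<and> j = i - 1)" for w j
    by (auto simp: hex_edges_eq)
  then have "rising_edge i u \<in> benz_E n r \<longleftrightarrow> (u, i) \<in> benzenoid_cells n r \<or>
      (u - 1, i - 1) \<in> benzenoid_cells n r"
    by (simp add: benz_E_def Bex_def split_paired_Ex conj_disj_distribL ex_disj_distrib)
  then show ?thesis
    using n_pos r_pos unfolding cell_iff is_rising_def by (smt (verit) of_nat_1 of_nat_mono)
qed

lemma vertical_in_E: "vertical_edge i u \<in> benz_E n r \<longleftrightarrow> is_vertical i u"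
proof -
  have "vertical_edge i u \<in> hex_edges (w, j) \<longleftrightarrow>
      (w = u \<and> j = i) \<or> (w = u - 1 \<and> j = i)" for w j
    by (auto simp: hex_edges_eq)
  then have "vertical_edge i u \<in> benz_E n r \<longleftrightarrow> (u, i) \<in> benzenoid_cells n r \<or>
      (u - 1, i) \<in> benzenoid_cells n r"
    by (simp add: benz_E_def Bex_def split_paired_Ex conj_disj_distribL ex_disj_distrib)
  then show ?thesis
    using n_pos r_pos unfolding cell_iff is_vertical_def by (smt (verit) of_nat_1 of_nat_mono)
qed

lemma ball_V_iff:
  "(\<forall>v\<in>benz_V n r. P v) \<longleftrightarrow>
    (\<forall>i u. is_peak i u \<longrightarrow> P (peak i u)) \<and> (\<forall>i u. is_valley i u \<longrightarrow> P (valley i u))"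
proof -
  have "v \<in> benz_V n r \<longleftrightarrow> (\<exists>i u. v = peak i u \<and> is_peak i u) \<or> (\<exists>i u. v = valley i u \<and> is_valley i u)"
    for v
  proof
    assume v: "v \<in> benz_V n r"
    then obtain i u where "v = peak i u \<or> v = valley i u"
      unfolding benz_V_def by (auto simp: set_hex_vertices)
    with v show "(\<exists>i u. v = peak i u \<and> is_peak i u) \<or> (\<exists>i u. v = valley i u \<and> is_valley i u)"
      using peak_in_V valley_in_V by auto
  qed (use peak_in_V valley_in_V in auto)
  then show ?thesis
    by metis
qed

lemma E_cases:
  assumes "x \<in> benz_E n r"
  obtains i u where "x = falling_edge i u" | i u where "x = rising_edge i u"
    | i u where "x = vertical_edge i u"
  using assms unfolding benz_E_def by (auto simp: hex_edges_eq)

text \<open>All three tiling edges at the peak appear, whether or not they belong to the benzenoid: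
  those outside contribute 0 because M consists of benzenoid edges.\<close>

lemma peak_ex1_iff:
  assumes "M \<subseteq> benz_E n r"
  shows "(\<exists>!x. x \<in> M \<and> peak i u \<in> x) \<longleftrightarrow>
    of_bool (rising_edge i u \<in> M) + of_bool (falling_edge i u \<in> M)
      + of_bool (vertical_edge (i - 1) u \<in> M) = (1::int)"
proof -
  have *: "x \<in> M \<and> peak i u \<in> x \<longleftrightarrow>
      x \<in> M \<and> (x = rising_edge i u \<or> x = falling_edge i u \<or> x = vertical_edge (i - 1) u)" for x
  proof (cases "x \<in> M")
    case True
    with assms have "x \<in> benz_E n r" by blast
    then show ?thesis by (cases rule: E_cases) auto
  qed simp
  show ?thesis
    unfolding * by (rule ex1_among_three) simp_all
qed

lemma valley_ex1_iff:
  assumes "M \<subseteq> benz_E n r"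
  shows "(\<exists>!x. x \<in> M \<and> valley i u \<in> x) \<longleftrightarrow>
    of_bool (rising_edge i u \<in> M) + of_bool (falling_edge i (u - 1) \<in> M)
      + of_bool (vertical_edge i u \<in> M) = (1::int)"
proof -
  have *: "x \<in> M \<and> valley i u \<in> x \<longleftrightarrow>
      x \<in> M \<and> (x = rising_edge i u \<or> x = falling_edge i (u - 1) \<or> x = vertical_edge i u)" for x
  proof (cases "x \<in> M")
    case True
    with assms have "x \<in> benz_E n r" by blast
    then show ?thesis by (cases rule: E_cases) auto
  qed simp
  show ?thesis
    unfolding * by (rule ex1_among_three) simp_all
qed

lemma kekule_iff:
  "M \<in> kekule_structures n r \<longleftrightarrow> M \<subseteq> benz_E n r \<and>
    (\<forall>i u. is_peak i u \<longrightarrow> of_bool (rising_edge i u \<in> M) + of_bool (falling_edge i u \<in> M)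
      + of_bool (vertical_edge (i - 1) u \<in> M) = (1::int)) \<and>
    (\<forall>i u. is_valley i u \<longrightarrow> of_bool (rising_edge i u \<in> M) + of_bool (falling_edge i (u - 1) \<in> M)
      + of_bool (vertical_edge i u \<in> M) = (1::int))"
  (is "_ \<longleftrightarrow> _ \<and> ?P \<and> ?Q")
proof -
  have "(\<forall>v\<in>benz_V n r. \<exists>!x. x \<in> M \<and> v \<in> x) \<longleftrightarrow> ?P \<and> ?Q" if "M \<subseteq> benz_E n r"
    unfolding ball_V_iff peak_ex1_iff[OF that] valley_ex1_iff[OF that] ..
  then show ?thesis
    unfolding kekule_structures_def perfect_matchings_def by blast
qed

section \<open>Height functions and the matchings they define\<close>

definition heights :: "(int \<Rightarrow> int \<Rightarrow> int) set" where
  "heights = {D.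
     (\<forall>i u. D i u \<le> D (i + 1) u) \<and> (\<forall>i u. D i u \<le> D i (u + 1)) \<and>
     (\<forall>i u. D (i + 1) (u + 1) \<le> D i u + 1) \<and>
     (\<forall>i u. u < 0 \<longrightarrow> D i u = 0) \<and> (\<forall>i u. u > int n \<longrightarrow> D i u = 2) \<and>
     (\<forall>i u. i < 0 \<longrightarrow> D i u = of_bool (u \<ge> int n) + of_bool (u \<ge> int n + 1)) \<and>
     (\<forall>i u. i > int r \<longrightarrow> D i u = of_bool (u \<ge> 0) + of_bool (u \<ge> 1))}"

lemma heightsD:
  assumes "D \<in> heights"
  shows "D i u \<le> D (i + 1) u" "D i u \<le> D i (u + 1)" "D (i + 1) (u + 1) \<le> D i u + 1"
    "u < 0 \<Longrightarrow> D i u = 0" "u > int n \<Longrightarrow> D i u = 2"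
    "i < 0 \<Longrightarrow> D i u = of_bool (u \<ge> int n) + of_bool (u \<ge> int n + 1)"
    "i > int r \<Longrightarrow> D i u = of_bool (u \<ge> 0) + of_bool (u \<ge> 1)"
  using assms unfolding heights_def by blast+

text \<open>Each edge compares the two cells it separates. Crossing a matched vertical or falling
  edge raises the height by 1, whereas crossing a rising edge raises it by 1 unless the edge is
  matched; hence the equality in the second set.\<close>

definition matching_of :: "(int \<Rightarrow> int \<Rightarrow> int) \<Rightarrow> (int \<times> int) set set" where
  "matching_of D =
     {falling_edge i u | i u. is_falling i u \<and> D i u \<noteq> D (i - 1) u} \<union>
     {rising_edge i u | i u. is_rising i u \<and> D i u = D (i - 1) (u - 1)} \<union>
     {vertical_edge i u | i u. is_vertical i u \<and> D i u \<noteq> D i (u - 1)}"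

lemma in_matching_of [simp]:
  "falling_edge i u \<in> matching_of D \<longleftrightarrow> is_falling i u \<and> D i u \<noteq> D (i - 1) u"
  "rising_edge i u \<in> matching_of D \<longleftrightarrow> is_rising i u \<and> D i u = D (i - 1) (u - 1)"
  "vertical_edge i u \<in> matching_of D \<longleftrightarrow> is_vertical i u \<and> D i u \<noteq> D i (u - 1)"
  unfolding matching_of_def by auto

lemma heights_step:
  assumes "D \<in> heights"
  shows "D (i - 1) u \<le> D i u" "D i (u - 1) \<le> D i u" "D i u \<le> D (i - 1) (u - 1) + 1"
  using heightsD(1)[OF assms, of "i - 1" u] heightsD(2)[OF assms, of i "u - 1"]
    heightsD(3)[OF assms, of "i - 1" "u - 1"] by auto

text \<open>These are the values at the two removed corner cells. They are not imposed in
  \<open>heights\<close>; the diagonal inequality, applied once on either side of the corner, forces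
  them.\<close>

lemma heights_corner:
  assumes D: "D \<in> heights"
  shows "D (int r) 0 = 1" "D 0 (int n) = 1"
proof -
  show "D (int r) 0 = 1"
    using heights_step(3)[OF D, of "int r" 0] heights_step(3)[OF D, of "int r + 1" 1]
      heightsD(4)[OF D, of "-1" "int r - 1"] heightsD(7)[OF D, of "int r + 1" 1] by simp
  show "D 0 (int n) = 1"
    using heights_step(3)[OF D, of 0 "int n"] heights_step(3)[OF D, of 1 "int n + 1"]
      heightsD(6)[OF D, of "-1" "int n - 1"] heightsD(5)[OF D, of "int n + 1" 1] by simp
qed

text \<open>Around any vertex of the tiling exactly one of the three possible height changes occurs;
  at a vertex of the benzenoid the boundary conditions exclude the edges outside it.\<close>

lemma matching_of_kekule:
  assumes D: "D \<in> heights"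
  shows "matching_of D \<in> kekule_structures n r"
  unfolding kekule_iff
proof (intro conjI allI impI)
  show "matching_of D \<subseteq> benz_E n r"
    unfolding matching_of_def using falling_in_E rising_in_E vertical_in_E by auto
next
  fix i u
  assume ok: "is_peak i u"
  have f: "is_falling i u \<or> D i u = D (i - 1) u"
    using ok heightsD(5)[OF D, of u i] heightsD(5)[OF D, of u "i - 1"]
    unfolding is_peak_def is_falling_def by (cases "u \<le> int n") auto
  \<comment> \<open>The two exceptional peaks lie on the removed cell (0, r), and their rising edges
    are sides of that cell only.\<close>
  have "is_rising i u \<or> (i = int r \<and> u = 0) \<or> (i = int r + 1 \<and> u = 1)"
    using ok unfolding is_peak_def is_rising_def by linarith
  then have e: "is_rising i u \<or> D i u \<noteq> D (i - 1) (u - 1)"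
    using heights_corner(1)[OF D] heightsD(4)[OF D, of "-1" "int r - 1"]
      heightsD(7)[OF D, of "int r + 1" 1] by auto
  have d: "is_vertical (i - 1) u \<or> D (i - 1) u = D (i - 1) (u - 1)"
    using ok heightsD(6)[OF D, of "i - 1" u] heightsD(6)[OF D, of "i - 1" "u - 1"]
    unfolding is_peak_def is_vertical_def by (cases "i = 0") auto
  have "D i u \<noteq> D (i - 1) u \<and> D i u \<noteq> D (i - 1) (u - 1) \<and> D (i - 1) u = D (i - 1) (u - 1) \<or>
     D i u = D (i - 1) u \<and> D i u = D (i - 1) (u - 1) \<and> D (i - 1) u = D (i - 1) (u - 1) \<or>
     D i u = D (i - 1) u \<and> D i u \<noteq> D (i - 1) (u - 1) \<and> D (i - 1) u \<noteq> D (i - 1) (u - 1)"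
    using heights_step[OF D, of i u] heights_step(2)[OF D, of "i - 1" u] by linarith
  then show "of_bool (rising_edge i u \<in> matching_of D) + of_bool (falling_edge i u \<in> matching_of D)
      + of_bool (vertical_edge (i - 1) u \<in> matching_of D) = (1::int)"
    using e f d by auto
next
  fix i u
  assume ok: "is_valley i u"
  have f: "is_falling i (u - 1) \<or> D i (u - 1) = D (i - 1) (u - 1)"
    using ok heightsD(4)[OF D, of "u - 1" i] heightsD(4)[OF D, of "u - 1" "i - 1"]
    unfolding is_valley_def is_falling_def by (cases "u = 0") auto
  \<comment> \<open>The two exceptional valleys lie on the other removed cell, (n, 0).\<close>
  have "is_rising i u \<or> (i = 0 \<and> u = int n) \<or> (i = 1 \<and> u = int n + 1)"
    using ok unfolding is_valley_def is_rising_def by linarith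
  then have e: "is_rising i u \<or> D i u \<noteq> D (i - 1) (u - 1)"
    using heights_corner(2)[OF D] heightsD(6)[OF D, of "-1" "int n - 1"]
      heightsD(5)[OF D, of "int n + 1" 1] by auto
  have d: "is_vertical i u \<or> D i u = D i (u - 1)"
    using ok heightsD(7)[OF D, of i u] heightsD(7)[OF D, of i "u - 1"]
    unfolding is_valley_def is_vertical_def by (cases "i = int r + 1") auto
  have "D i (u - 1) \<noteq> D (i - 1) (u - 1) \<and> D i u \<noteq> D (i - 1) (u - 1) \<and> D i u = D i (u - 1) \<or>
     D i (u - 1) = D (i - 1) (u - 1) \<and> D i u = D (i - 1) (u - 1) \<and> D i u = D i (u - 1) \<or>
     D i (u - 1) = D (i - 1) (u - 1) \<and> D i u \<noteq> D (i - 1) (u - 1) \<and> D i u \<noteq> D i (u - 1)"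
    using heights_step[OF D, of i u] heights_step[OF D, of i "u - 1"] by linarith
  then show "of_bool (rising_edge i u \<in> matching_of D) + of_bool (falling_edge i (u - 1) \<in> matching_of D)
      + of_bool (vertical_edge i u \<in> matching_of D) = (1::int)"
    using e f d by auto
qed

lemma heights_vertical_boundary:
  assumes D: "D \<in> heights" and E: "E \<in> heights" and "\<not> is_vertical i u"
    and "D i (u - 1) = E i (u - 1)"
  shows "D i u = E i u"
proof -
  have "i < 0 \<or> i > int r \<or> u < 0 \<or> u > int n \<or> (i = int r \<and> u = 0)"
    using assms(3) unfolding is_vertical_def by auto
  moreover have "D (int r) 0 = E (int r) 0"
    using heights_corner(1)[OF D] heights_corner(1)[OF E] by simp
  ultimately show ?thesis
    using heightsD(4-7)[OF D] heightsD(4-7)[OF E] by auto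
qed

lemma vertical_step:
  assumes D: "D \<in> heights"
  shows "D i u = D i (u - 1) \<or> D i u = D i (u - 1) + 1"
  using heights_step(2)[OF D, of i u] heights_step(3)[OF D, of i u]
    heights_step(1)[OF D, of i "u - 1"] by linarith

text \<open>The vertical edges alone determine the heights: each row starts with 0 at position -1,
  and every step to the right is 0 or 1, according to a vertical edge or, outside the benzenoid, to
  the boundary values.\<close>

lemma inj_matching_of: "inj_on matching_of heights"
proof (intro inj_onI ext)
  fix D E :: "int \<Rightarrow> int \<Rightarrow> int" and i u :: int
  assume D: "D \<in> heights" and E: "E \<in> heights" and eq: "matching_of D = matching_of E"
  have local_step: "D i u = E i u" if "D i (u - 1) = E i (u - 1)" for u
  proof (cases "is_vertical i u")
    case True
    then have "D i u \<noteq> D i (u - 1) \<longleftrightarrow> E i u \<noteq> E i (u - 1)"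
      using eq in_matching_of(3) by metis
    then show ?thesis
      using vertical_step[OF D, of i u] vertical_step[OF E, of i u] that by linarith
  next
    case False
    then show ?thesis
      using heights_vertical_boundary[OF D E] that by blast
  qed
  show "D i u = E i u"
  proof (cases "u < 0")
    case True
    then show ?thesis using heightsD(4)[OF D] heightsD(4)[OF E] by auto
  next
    case False
    then have "-1 \<le> u" by simp
    then show ?thesis
    proof (induction u rule: int_ge_induct)
      case base
      then show ?case using heightsD(4)[OF D] heightsD(4)[OF E] by auto
    next
      case (step u)
      then show ?case using local_step[of "u + 1"] by simp
    qed
  qed
qed


section \<open>From a Kekule structure to its height function\<close>

text \<open>A matching of the benzenoid extends by fixed edges to a matching of the whole tiling; these
  edges are the extra disjuncts in the first two definitions.\<close>

definition vertical_count :: "(int \<times> int) set set \<Rightarrow> int \<Rightarrow> int \<Rightarrow> int" where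
  "vertical_count M i u = of_bool (vertical_edge i u \<in> M \<or> (i < 0 \<and> (u = int n \<or> u = int n + 1)) \<or>
     (i > int r \<and> (u = 0 \<or> u = 1)) \<or> (i = 0 \<and> u = int n + 1) \<or> (i = int r \<and> u = 0))"

definition rising_count :: "(int \<times> int) set set \<Rightarrow> int \<Rightarrow> int \<Rightarrow> int" where
  "rising_count M i u = of_bool (rising_edge i u \<in> M \<or> u < 0 \<or> u > int n + 1 \<or>
     (i < 0 \<and> u \<noteq> int n \<and> u \<noteq> int n + 1) \<or> (i > int r + 1 \<and> u \<noteq> 0 \<and> u \<noteq> 1))"

definition falling_count :: "(int \<times> int) set set \<Rightarrow> int \<Rightarrow> int \<Rightarrow> int" where
  "falling_count M i u = of_bool (falling_edge i u \<in> M)"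

lemmas count_defs = vertical_count_def rising_count_def falling_count_def

lemma vertical_count_inside:
  assumes "is_vertical i u"
  shows "vertical_count M i u = of_bool (vertical_edge i u \<in> M)"
proof -
  have "\<not> i < 0" "\<not> i > int r" "\<not> (i = 0 \<and> u = int n + 1)" "\<not> (i = int r \<and> u = 0)"
    using assms unfolding is_vertical_def by simp_all
  then show ?thesis
    unfolding vertical_count_def by (intro arg_cong[of _ _ of_bool]) blast
qed

lemma rising_count_inside:
  assumes "is_rising i u"
  shows "rising_count M i u = of_bool (rising_edge i u \<in> M)"
proof -
  have "\<not> u < 0" "\<not> u > int n + 1" "\<not> i < 0" "\<not> i > int r + 1"
    using assms unfolding is_rising_def by simp_all
  then show ?thesis
    unfolding rising_count_def by (intro arg_cong[of _ _ of_bool]) blast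
qed

lemma count_nonneg:
  "0 \<le> falling_count M i u" "0 \<le> vertical_count M i u" "0 \<le> rising_count M i u"
  unfolding count_defs by (rule zero_less_eq_of_bool)+

text \<open>Starting the sum at 0 loses nothing for a Kekule structure: no vertical edge, matched or
  fixed, has a negative position.\<close>

definition height_of :: "(int \<times> int) set set \<Rightarrow> int \<Rightarrow> int \<Rightarrow> int" where
  "height_of M i u = (\<Sum>w = 0..u. vertical_count M i w)"

context
  fixes M
  assumes M: "M \<in> kekule_structures n r"
begin

lemma matching_edges:
  "falling_edge i u \<in> M \<Longrightarrow> is_falling i u"
  "rising_edge i u \<in> M \<Longrightarrow> is_rising i u"
  "vertical_edge i u \<in> M \<Longrightarrow> is_vertical i u"
  using M falling_in_E rising_in_E vertical_in_E unfolding kekule_iff by blast+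

text \<open>The extended matching covers every peak of the plane exactly once.\<close>

lemma peak_count: "rising_count M i u + falling_count M i u + vertical_count M (i - 1) u = 1"
proof (cases "is_peak i u")
  case True
  then have "of_bool (rising_edge i u \<in> M) + of_bool (falling_edge i u \<in> M)
      + of_bool (vertical_edge (i - 1) u \<in> M) = (1::int)"
    using M unfolding kekule_iff by blast
  moreover have "vertical_count M (i - 1) u = of_bool (vertical_edge (i - 1) u \<in> M)"
    "rising_count M i u = of_bool (rising_edge i u \<in> M)"
    using True r_pos n_pos unfolding count_defs is_peak_def by auto
  ultimately show ?thesis
    by (simp add: falling_count_def)
next
  case False
  then have "rising_edge i u \<notin> M" "falling_edge i u \<notin> M" "vertical_edge (i - 1) u \<notin> M"
    using matching_edges[of i u] matching_edges(3)[of "i - 1" u] n_pos r_pos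
    unfolding is_peak_def is_rising_def is_falling_def is_vertical_def by auto
  \<comment> \<open>Away from the benzenoid a peak is covered by a fixed edge: a rising one exactly
    when it has no fixed vertical one.\<close>
  moreover have "(u < 0 \<or> u > int n + 1 \<or> (i < 0 \<and> u \<noteq> int n \<and> u \<noteq> int n + 1) \<or>
      (i > int r + 1 \<and> u \<noteq> 0 \<and> u \<noteq> 1)) \<longleftrightarrow>
      \<not> ((i - 1 < 0 \<and> (u = int n \<or> u = int n + 1)) \<or>
      (i - 1 > int r \<and> (u = 0 \<or> u = 1)) \<or> (i - 1 = 0 \<and> u = int n + 1) \<or> (i - 1 = int r \<and> u = 0))"
    using False n_pos r_pos unfolding is_peak_def by (smt (verit) of_nat_1 of_nat_mono)
  ultimately show ?thesis
    unfolding count_defs by (simp only: of_bool_eq simp_thms) simp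
qed

lemma valley_count: "rising_count M i u + falling_count M i (u - 1) + vertical_count M i u = 1"
proof (cases "is_valley i u")
  case True
  then have "of_bool (rising_edge i u \<in> M) + of_bool (falling_edge i (u - 1) \<in> M)
      + of_bool (vertical_edge i u \<in> M) = (1::int)"
    using M unfolding kekule_iff by blast
  moreover have "vertical_count M i u = of_bool (vertical_edge i u \<in> M)"
    "rising_count M i u = of_bool (rising_edge i u \<in> M)"
    using True r_pos n_pos unfolding count_defs is_valley_def by auto
  ultimately show ?thesis
    by (simp add: falling_count_def)
next
  case False
  then have "rising_edge i u \<notin> M" "falling_edge i (u - 1) \<notin> M" "vertical_edge i u \<notin> M"
    using matching_edges[of i u] matching_edges(1)[of i "u - 1"] n_pos r_pos
    unfolding is_valley_def is_rising_def is_falling_def is_vertical_def by auto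
  moreover have "(u < 0 \<or> u > int n + 1 \<or> (i < 0 \<and> u \<noteq> int n \<and> u \<noteq> int n + 1) \<or>
      (i > int r + 1 \<and> u \<noteq> 0 \<and> u \<noteq> 1)) \<longleftrightarrow>
      \<not> ((i < 0 \<and> (u = int n \<or> u = int n + 1)) \<or>
      (i > int r \<and> (u = 0 \<or> u = 1)) \<or> (i = 0 \<and> u = int n + 1) \<or> (i = int r \<and> u = 0))"
    using False n_pos r_pos unfolding is_valley_def by (smt (verit) of_nat_1 of_nat_mono)
  ultimately show ?thesis
    unfolding count_defs by (simp only: of_bool_eq simp_thms) simp
qed

lemma height_of_neg: "u < 0 \<Longrightarrow> height_of M i u = 0"
  by (simp add: height_of_def)

lemma height_of_vertical: "height_of M i u = height_of M i (u - 1) + vertical_count M i u"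
proof (cases "u < 0")
  case True
  then have "vertical_edge i u \<notin> M"
    using matching_edges(3)[of i u] unfolding is_vertical_def by auto
  with True show ?thesis
    by (auto simp: height_of_neg vertical_count_def)
next
  case False
  then have "{0..u} = insert u {0..u - 1}"
    by auto
  then show ?thesis
    by (simp add: height_of_def)
qed

text \<open>Follow the zigzag between rows i - 1 and i. Subtracting the peak equation from the
  valley equation at u + 1 cancels the rising edge, so the difference of the two partial sums
  changes exactly as the falling count does.\<close>

lemma height_of_falling: "height_of M i u = height_of M (i - 1) u + falling_count M i u"
proof (cases "u < 0")
  case True
  then have "falling_edge i u \<notin> M"
    using matching_edges(1)[of i u] unfolding is_falling_def by auto
  with True show ?thesis
    by (auto simp: height_of_neg falling_count_def)
next
  case False
  then have "-1 \<le> u" by simp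
  then show ?thesis
  proof (induction u rule: int_ge_induct)
    case base
    have "falling_edge i (-1) \<notin> M"
      using matching_edges(1)[of i "-1"] unfolding is_falling_def by auto
    then show ?case
      by (auto simp: height_of_neg falling_count_def)
  next
    case (step u)
    then show ?case
      using height_of_vertical[of i "u + 1"] height_of_vertical[of "i - 1" "u + 1"]
        peak_count[of i "u + 1"] valley_count[of i "u + 1"] by simp
  qed
qed

lemma height_of_rising: "height_of M i u = height_of M (i - 1) (u - 1) + 1 - rising_count M i u"
  using height_of_falling[of i u] height_of_vertical[of "i - 1" u] peak_count[of i u] by simp

lemma height_of_top:
  assumes "i < 0"
  shows "height_of M i u = of_bool (u \<ge> int n) + of_bool (u \<ge> int n + 1)"
proof (cases "u < 0")
  case True
  then show ?thesis by (simp add: height_of_neg)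
next
  case False
  then have "-1 \<le> u" by simp
  then show ?thesis
  proof (induction u rule: int_ge_induct)
    case base
    then show ?case by (simp add: height_of_neg)
  next
    case (step u)
    have "vertical_edge i (u + 1) \<notin> M"
      using assms matching_edges(3)[of i "u + 1"] unfolding is_vertical_def by auto
    then show ?case
      using step assms height_of_vertical[of i "u + 1"] by (auto simp: vertical_count_def)
  qed
qed

lemma height_of_bottom:
  assumes "i > int r"
  shows "height_of M i u = of_bool (u \<ge> 0) + of_bool (u \<ge> 1)"
proof (cases "u < 0")
  case True
  then show ?thesis by (simp add: height_of_neg)
next
  case False
  then have "-1 \<le> u" by simp
  then show ?thesis
  proof (induction u rule: int_ge_induct)
    case base
    then show ?case by (simp add: height_of_neg)
  next
    case (step u)
    have "vertical_edge i (u + 1) \<notin> M"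
      using assms matching_edges(3)[of i "u + 1"] unfolding is_vertical_def by auto
    then show ?case
      using step assms height_of_vertical[of i "u + 1"] by (auto simp: vertical_count_def)
  qed
qed

text \<open>No falling edge occurs beyond position n, so consecutive rows agree there. The value 2
  thus descends from the rows above the benzenoid, where it counts the two fixed vertical
  edges.\<close>

lemma height_of_right:
  assumes "u > int n"
  shows "height_of M i u = 2"
proof (cases "i < -1")
  case True
  then show ?thesis using assms by (simp add: height_of_top)
next
  case False
  then have "-1 \<le> i" by simp
  then show ?thesis
  proof (induction i rule: int_ge_induct)
    case base
    then show ?case using assms by (simp add: height_of_top)
  next
    case (step i)
    have "falling_edge (i + 1) u \<notin> M"
      using assms matching_edges(1)[of "i + 1" u] unfolding is_falling_def by auto
    then show ?case
      using step height_of_falling[of "i + 1" u] by (simp add: falling_count_def)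
  qed
qed

lemma height_of_heights: "height_of M \<in> heights"
  unfolding heights_def
proof (intro CollectI conjI allI impI)
  fix i u
  show "height_of M i u \<le> height_of M (i + 1) u"
    using height_of_falling[of "i + 1" u] count_nonneg(1)[of M "i + 1" u] by simp
  show "height_of M i u \<le> height_of M i (u + 1)"
    using height_of_vertical[of i "u + 1"] count_nonneg(2)[of M i "u + 1"] by simp
  show "height_of M (i + 1) (u + 1) \<le> height_of M i u + 1"
    using height_of_rising[of "i + 1" "u + 1"] count_nonneg(3)[of M "i + 1" "u + 1"] by simp
qed (simp_all add: height_of_neg height_of_right height_of_top height_of_bottom)

lemma matching_of_height_of: "matching_of (height_of M) = M"
proof (rule set_eqI)
  fix x
  have f: "falling_edge i u \<in> matching_of (height_of M) \<longleftrightarrow> falling_edge i u \<in> M" for i u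
    using matching_edges(1)[of i u] height_of_falling[of i u] by (auto simp: falling_count_def)
  have e: "rising_edge i u \<in> matching_of (height_of M) \<longleftrightarrow> rising_edge i u \<in> M" for i u
    using matching_edges(2)[of i u] height_of_rising[of i u] rising_count_inside[of i u M]
    by (cases "is_rising i u") auto
  have d: "vertical_edge i u \<in> matching_of (height_of M) \<longleftrightarrow> vertical_edge i u \<in> M" for i u
    using matching_edges(3)[of i u] height_of_vertical[of i u] vertical_count_inside[of i u M]
    by (cases "is_vertical i u") auto
  have "x \<in> benz_E n r" if "x \<in> M \<or> x \<in> matching_of (height_of M)"
    using that M matching_of_kekule[OF height_of_heights] unfolding kekule_iff by blast
  then show "x \<in> matching_of (height_of M) \<longleftrightarrow> x \<in> M"
    using f e d by (metis E_cases)
qed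

end

lemma bij_matching_of: "bij_betw matching_of heights (kekule_structures n r)"
proof (rule bij_betw_imageI[OF inj_matching_of])
  show "matching_of ` heights = kekule_structures n r"
    using matching_of_kekule matching_of_height_of height_of_heights by (auto, metis imageI)
qed

section \<open>From matrices to height functions\<close>

text \<open>Entries to the left of column 1 count as minus infinity, entries to the right of
  column n as plus infinity; the two rows are shifted against each other by one column.\<close>

definition upper_step :: "(nat \<times> nat \<Rightarrow> nat) \<Rightarrow> int \<Rightarrow> int \<Rightarrow> bool" where
  "upper_step A i u \<longleftrightarrow> u > 0 \<and> (u > int n \<or> int (A (1, nat u)) > int r - i + 1)"

definition lower_step :: "(nat \<times> nat \<Rightarrow> nat) \<Rightarrow> int \<Rightarrow> int \<Rightarrow> bool" where
  "lower_step A i u \<longleftrightarrow> u \<ge> 0 \<and> (u \<ge> int n \<or> int (A (2, nat (u + 1))) > int r - i)"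

definition height_of_mat :: "(nat \<times> nat \<Rightarrow> nat) \<Rightarrow> int \<Rightarrow> int \<Rightarrow> int" where
  "height_of_mat A i u = of_bool (upper_step A i u) + of_bool (lower_step A i u)"

abbreviation "mats \<equiv> weakly_increasing_mats n (r + 1)"

lemma matsD:
  assumes "A \<in> mats"
  shows "i \<in> {1,2} \<Longrightarrow> 1 \<le> j \<Longrightarrow> j \<le> n \<Longrightarrow> 1 \<le> A (i, j) \<and> A (i, j) \<le> r + 1"
    "i \<in> {1,2} \<Longrightarrow> i' \<in> {1,2} \<Longrightarrow> 1 \<le> j \<Longrightarrow> j' \<le> n \<Longrightarrow> i \<le> i' \<Longrightarrow> j \<le> j' \<Longrightarrow> A (i, j) \<le> A (i', j')"
proof -
  show "i \<in> {1,2} \<Longrightarrow> 1 \<le> j \<Longrightarrow> j \<le> n \<Longrightarrow> 1 \<le> A (i, j) \<and> A (i, j) \<le> r + 1"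
    using assms PiE_mem[of A "{1,2} \<times> {1..n}" "\<lambda>_. {1..r + 1}" "(i, j)"]
    unfolding weakly_increasing_mats_def by auto
  show "i \<in> {1,2} \<Longrightarrow> i' \<in> {1,2} \<Longrightarrow> 1 \<le> j \<Longrightarrow> j' \<le> n \<Longrightarrow> i \<le> i' \<Longrightarrow> j \<le> j' \<Longrightarrow> A (i, j) \<le> A (i', j')"
    using assms unfolding weakly_increasing_mats_def by auto
qed

lemma entry_bounds:
  assumes "A \<in> mats" "l \<in> {1,2}" "0 < w" "w \<le> int n"
  shows "1 \<le> int (A (l, nat w))" "int (A (l, nat w)) \<le> int r + 1"
proof -
  have "1 \<le> nat w" "nat w \<le> n"
    using assms by auto
  from matsD(1)[OF assms(1,2) this]
  show "1 \<le> int (A (l, nat w))" "int (A (l, nat w)) \<le> int r + 1"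
    by linarith+
qed

text \<open>Nesting of the two regions: it lets the sum in \<open>height_of_mat\<close> be decoded,
  with height at least 2 meaning \<open>upper_step\<close> and height at least 1 meaning
  \<open>lower_step\<close>.\<close>

lemma lower_step_of_upper_step:
  assumes A: "A \<in> mats" and "upper_step A i u"
  shows "lower_step A i u"
proof (cases "u < int n")
  case True
  then have "A (1, nat u) \<le> A (2, nat (u + 1))"
    using assms(2) unfolding upper_step_def by (intro matsD(2)[OF A]) auto
  with assms(2) True show ?thesis
    unfolding upper_step_def lower_step_def by auto
next
  case False
  then show ?thesis
    by (auto simp: lower_step_def)
qed

text \<open>Both steps compare with r - i in the same column u + 1, so this is the inequality
  between the two entries of a column; it yields the diagonal condition on heights.\<close>

lemma lower_step_of_upper_step_diag:
  assumes A: "A \<in> mats" and "upper_step A (i + 1) (u + 1)"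
  shows "lower_step A i u"
proof (cases "u < int n")
  case True
  then have "A (1, nat (u + 1)) \<le> A (2, nat (u + 1))"
    using assms(2) unfolding upper_step_def by (intro matsD(2)[OF A]) auto
  with assms(2) True show ?thesis
    unfolding upper_step_def lower_step_def by auto
next
  case False
  with n_pos show ?thesis
    by (auto simp: lower_step_def)
qed

lemma upper_step_Suc:
  assumes A: "A \<in> mats" and "upper_step A i u"
  shows "upper_step A i (u + 1)"
proof (cases "u < int n")
  case True
  then have "A (1, nat u) \<le> A (1, nat (u + 1))"
    using assms(2) unfolding upper_step_def by (intro matsD(2)[OF A]) auto
  with assms(2) True show ?thesis
    unfolding upper_step_def by auto
next
  case False
  with n_pos show ?thesis
    by (auto simp: upper_step_def)
qed

lemma lower_step_Suc:
  assumes A: "A \<in> mats" and "lower_step A i u"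
  shows "lower_step A i (u + 1)"
proof (cases "u + 1 < int n")
  case True
  then have "A (2, nat (u + 1)) \<le> A (2, nat (u + 2))"
    using assms(2) unfolding lower_step_def by (intro matsD(2)[OF A]) auto
  with assms(2) True show ?thesis
    unfolding lower_step_def by (auto simp: add.assoc)
next
  case False
  with n_pos show ?thesis
    by (auto simp: lower_step_def)
qed

lemma height_of_mat_heights:
  assumes A: "A \<in> mats"
  shows "height_of_mat A \<in> heights"
  unfolding heights_def
proof (intro CollectI conjI allI impI)
  fix i u :: int
  show "height_of_mat A i u \<le> height_of_mat A (i + 1) u"
    by (auto simp: height_of_mat_def upper_step_def lower_step_def)
  show "height_of_mat A i u \<le> height_of_mat A i (u + 1)"
    using upper_step_Suc[OF A, of i u] lower_step_Suc[OF A, of i u]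
    by (auto simp: height_of_mat_def)
  show "height_of_mat A (i + 1) (u + 1) \<le> height_of_mat A i u + 1"
    using lower_step_of_upper_step_diag[OF A, of i u]
    by (auto simp: height_of_mat_def)
  show "height_of_mat A i u = 0" if "u < 0"
    using that by (auto simp: height_of_mat_def upper_step_def lower_step_def)
  show "height_of_mat A i u = 2" if "u > int n"
    using that by (auto simp: height_of_mat_def upper_step_def lower_step_def)
  show "height_of_mat A i u = of_bool (u \<ge> int n) + of_bool (u \<ge> int n + 1)" if "i < 0"
  proof -
    \<comment> \<open>For i < 0 the thresholds are at least r + 2 and r + 1, which no entry
      exceeds.\<close>
    have "upper_step A i u \<longleftrightarrow> u \<ge> int n + 1"
      using that entry_bounds[OF A, of 1 u] unfolding upper_step_def
      by (cases "0 < u \<and> u \<le> int n") auto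
    moreover have "lower_step A i u \<longleftrightarrow> u \<ge> int n"
      using that entry_bounds[OF A, of 2 "u + 1"] unfolding lower_step_def
      by (cases "0 \<le> u \<and> u < int n") auto
    ultimately show ?thesis by (simp add: height_of_mat_def)
  qed
  show "height_of_mat A i u = of_bool (u \<ge> 0) + of_bool (u \<ge> 1)" if "i > int r"
  proof -
    \<comment> \<open>For i > r both thresholds are at most 0, and every entry is at least
      1.\<close>
    have "upper_step A i u \<longleftrightarrow> u \<ge> 1"
      using that entry_bounds[OF A, of 1 u] unfolding upper_step_def
      by (cases "0 < u \<and> u \<le> int n") auto
    moreover have "lower_step A i u \<longleftrightarrow> u \<ge> 0"
      using that entry_bounds[OF A, of 2 "u + 1"] unfolding lower_step_def
      by (cases "0 \<le> u \<and> u < int n") auto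
    ultimately show ?thesis by (simp add: height_of_mat_def)
  qed
qed

lemma height_of_mat_ge_1:
  assumes "A \<in> mats"
  shows "height_of_mat A i u \<ge> 1 \<longleftrightarrow> lower_step A i u"
  using lower_step_of_upper_step[OF assms, of i u] by (auto simp: height_of_mat_def)

lemma height_of_mat_ge_2:
  assumes "A \<in> mats"
  shows "height_of_mat A i u \<ge> 2 \<longleftrightarrow> upper_step A i u"
  using lower_step_of_upper_step[OF assms, of i u] by (auto simp: height_of_mat_def)

lemma inj_height_of_mat: "inj_on height_of_mat mats"
proof (rule inj_onI)
  fix A B
  assume A: "A \<in> mats" and B: "B \<in> mats" and eq: "height_of_mat A = height_of_mat B"
  have upper: "upper_step A i u \<longleftrightarrow> upper_step B i u" and lower: "lower_step A i u \<longleftrightarrow> lower_step B i u" for i u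
    using height_of_mat_ge_1[OF A] height_of_mat_ge_1[OF B]
      height_of_mat_ge_2[OF A] height_of_mat_ge_2[OF B] eq by metis+
  show "A = B"
  proof (rule PiE_ext)
    show "A \<in> ({1,2} \<times> {1..n}) \<rightarrow>\<^sub>E {1..r + 1}" "B \<in> ({1,2} \<times> {1..n}) \<rightarrow>\<^sub>E {1..r + 1}"
      using A B unfolding weakly_increasing_mats_def by auto
    fix x :: "nat \<times> nat"
    assume "x \<in> {1,2} \<times> {1..n}"
    then consider j where "x = (1, j)" "1 \<le> j" "j \<le> n" | j where "x = (2, j)" "1 \<le> j" "j \<le> n"
      by auto
    then show "A x = B x"
    proof cases
      case 1
      \<comment> \<open>The chosen row makes the threshold A x - 1, so the step holds for A and
        gives A x \<le> B x; the second instance gives the reverse.\<close>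
      then show ?thesis
        using upper[of "int r + 2 - int (A x)" "int j"] upper[of "int r + 2 - int (B x)" "int j"]
        by (auto simp: upper_step_def)
    next
      case 2
      then show ?thesis
        using lower[of "int r + 1 - int (A x)" "int j - 1"] lower[of "int r + 1 - int (B x)" "int j - 1"]
        by (auto simp: lower_step_def)
    qed
  qed
qed

section \<open>From height functions back to matrices\<close>

text \<open>The rows r + 2 - m and r + 1 - m come from solving \<open>upper_step\<close> and
  \<open>lower_step\<close> for i: they are the first rows where an entry equal to m exceeds its
  threshold.\<close>

definition mat_of_height :: "(int \<Rightarrow> int \<Rightarrow> int) \<Rightarrow> nat \<times> nat \<Rightarrow> nat" where
  "mat_of_height D = restrict (\<lambda>(l, j). SOME a. a \<le> r + 1 \<and> (\<forall>m\<in>{1..r + 1}. m \<le> a \<longleftrightarrow>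
     (if l = 1 then D (int r + 2 - int m) (int j) \<ge> 2 else D (int r + 1 - int m) (int j - 1) \<ge> 1)))
     ({1,2} \<times> {1..n})"

context
  fixes D
  assumes D: "D \<in> heights"
begin

lemma mat_of_height_threshold:
  assumes "l \<in> {1,2}" "1 \<le> j" "j \<le> n"
  shows "mat_of_height D (l, j) \<le> r + 1"
    "1 \<le> m \<Longrightarrow> m \<le> r + 1 \<Longrightarrow> m \<le> mat_of_height D (l, j) \<longleftrightarrow>
     (if l = 1 then D (int r + 2 - int m) (int j) \<ge> 2 else D (int r + 1 - int m) (int j - 1) \<ge> 1)"
proof -
  let ?Q = "\<lambda>m. if l = 1 then D (int r + 2 - int m) (int j) \<ge> 2 else D (int r + 1 - int m) (int j - 1) \<ge> 1"
  have "?Q m" if "?Q (Suc m)" for m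
    using that heightsD(1)[OF D, of "int r + 1 - int m" "int j"]
      heightsD(1)[OF D, of "int r - int m" "int j - 1"]
    by (auto simp: algebra_simps split: if_splits)
  then have "\<exists>a\<le>r + 1. \<forall>m\<in>{1..r + 1}. m \<le> a \<longleftrightarrow> ?Q m"
    by (rule threshold_exists)
  from someI_ex[OF this[unfolded Bex_def]]
  have *: "mat_of_height D (l, j) \<le> r + 1 \<and>
      (\<forall>m\<in>{1..r + 1}. m \<le> mat_of_height D (l, j) \<longleftrightarrow> ?Q m)"
    using assms unfolding mat_of_height_def by simp
  then show "mat_of_height D (l, j) \<le> r + 1" by simp
  show "m \<le> mat_of_height D (l, j) \<longleftrightarrow> ?Q m" if "1 \<le> m" "m \<le> r + 1"
    using * that by auto
qed

text \<open>Drops the bound m \<le> r + 1, so that rows arbitrarily far above the benzenoid can be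
  translated too: there height 2 is not reached at positions up to n.\<close>

lemma le_mat_of_height_1:
  assumes "1 \<le> j" "j \<le> n" "1 \<le> m"
  shows "m \<le> mat_of_height D (1, j) \<longleftrightarrow> D (int r + 2 - int m) (int j) \<ge> 2"
proof (cases "m \<le> r + 1")
  case True
  then show ?thesis using mat_of_height_threshold(2)[of 1 j m] assms by simp
next
  case False
  have "D (int r + 2 - int m) (int j) \<le> 1"
  proof (cases "m = r + 2")
    \<comment> \<open>This is row 0, just below the imposed boundary rows; the diagonal inequality
      from row -1 leaves height at most 1.\<close>
    case True
    then show ?thesis
      using heights_step(3)[OF D, of 0 "int j"] heightsD(6)[OF D, of "-1" "int j - 1"] assms by auto
  next
    case neq: False
    with False show ?thesis
      using heightsD(6)[OF D, of "int r + 2 - int m" "int j"] assms by auto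
  qed
  then show ?thesis
    using False mat_of_height_threshold(1)[of 1 j] assms by auto
qed

lemma le_mat_of_height_2:
  assumes "1 \<le> j" "j \<le> n" "1 \<le> m"
  shows "m \<le> mat_of_height D (2, j) \<longleftrightarrow> D (int r + 1 - int m) (int j - 1) \<ge> 1"
proof (cases "m \<le> r + 1")
  case True
  then show ?thesis using mat_of_height_threshold(2)[of 2 j m] assms by simp
next
  case False
  then have "D (int r + 1 - int m) (int j - 1) = 0"
    using heightsD(6)[OF D, of "int r + 1 - int m" "int j - 1"] assms by auto
  then show ?thesis
    using False mat_of_height_threshold(1)[of 2 j] assms by auto
qed

lemma mat_of_height_pos:
  assumes "l \<in> {1,2}" "1 \<le> j" "j \<le> n"
  shows "1 \<le> mat_of_height D (l, j)"
proof (cases "l = 1")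
  case True
  then show ?thesis
    using le_mat_of_height_1[of j 1] assms heightsD(7)[OF D, of "int r + 1" "int j"]
    by (simp add: add.commute)
next
  case False
  then show ?thesis
    using le_mat_of_height_2[of j 1] assms heightsD(7)[OF D, of "int r + 1" "int j"]
      heights_step(3)[OF D, of "int r + 1" "int j"] by (simp add: add.commute)
qed

lemma heights_mono: "u \<le> w \<Longrightarrow> D i u \<le> D i w"
  by (induction w rule: int_ge_induct) (use heightsD(2)[OF D] order_trans in blast)+

lemma mat_of_height_mats: "mat_of_height D \<in> mats"
  unfolding weakly_increasing_mats_def
proof (intro CollectI conjI allI impI)
  show "mat_of_height D \<in> ({1,2} \<times> {1..n}) \<rightarrow>\<^sub>E {1..r + 1}"
  proof (rule PiE_I)
    fix x :: "nat \<times> nat"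
    assume "x \<in> {1,2} \<times> {1..n}"
    then show "mat_of_height D x \<in> {1..r + 1}"
      using mat_of_height_pos mat_of_height_threshold(1) by (cases x) auto
  next
    fix x :: "nat \<times> nat"
    assume "x \<notin> {1,2} \<times> {1..n}"
    then show "mat_of_height D x = undefined"
      by (simp add: mat_of_height_def)
  qed
next
  fix i j i' j' :: nat
  assume "(i, j) \<in> {1,2} \<times> {1..n}" "(i', j') \<in> {1,2} \<times> {1..n}" "i \<le> i'" "j \<le> j'"
  then have j: "1 \<le> j" "j \<le> n" "1 \<le> j'" "j' \<le> n" "j \<le> j'"
    and i: "i = 1 \<and> i' = 1 \<or> i = 1 \<and> i' = 2 \<or> i = 2 \<and> i' = 2"
    by auto
  \<comment> \<open>The smaller entry itself serves as test value: m \<le> m becomes a height bound,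
    which is moved to the other position and read back.\<close>
  define m where "m = mat_of_height D (i, j)"
  have m: "1 \<le> m"
    using mat_of_height_pos[of i j] i j unfolding m_def by auto
  have "m \<le> mat_of_height D (i', j')"
    using i
  proof (elim disjE)
    assume "i = 1 \<and> i' = 1"
    then show ?thesis
      using le_mat_of_height_1[of j m] le_mat_of_height_1[of j' m] j m
        heights_mono[of "int j" "int j'" "int r + 2 - int m"] by (simp add: m_def)
  next
    assume "i = 1 \<and> i' = 2"
    have "int r + 2 - int m - 1 = int r + 1 - int m"
      by simp
    \<comment> \<open>Height 2 at position j' gives height 1 one row up and one position to the
      left, exactly where the second matrix row is read.\<close>
    with heights_step(3)[OF D, of "int r + 2 - int m" "int j'"]
    have "D (int r + 2 - int m) (int j') \<le> D (int r + 1 - int m) (int j' - 1) + 1"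
      by metis
    with \<open>i = 1 \<and> i' = 2\<close> show ?thesis
      using le_mat_of_height_1[of j m] le_mat_of_height_2[of j' m] j m
        heights_mono[of "int j" "int j'" "int r + 2 - int m"] by (simp add: m_def)
  next
    assume "i = 2 \<and> i' = 2"
    then show ?thesis
      using le_mat_of_height_2[of j m] le_mat_of_height_2[of j' m] j m
        heights_mono[of "int j - 1" "int j' - 1" "int r + 1 - int m"] by (simp add: m_def)
  qed
  then show "mat_of_height D (i, j) \<le> mat_of_height D (i', j')"
    by (simp add: m_def)
qed

lemma heights_bounds: "0 \<le> D i u" "D i u \<le> 2"
proof -
  have "D i (min (-1) u) \<le> D i u" "D i u \<le> D i (max (int n + 1) u)"
    by (intro heights_mono; simp)+
  then show "0 \<le> D i u" "D i u \<le> 2"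
    using heightsD(4)[OF D, of "min (-1) u" i] heightsD(5)[OF D, of "max (int n + 1) u" i] by auto
qed

lemma upper_step_mat_of_height: "upper_step (mat_of_height D) i u \<longleftrightarrow> D i u \<ge> 2"
proof -
  consider "u < 0" | "u = 0" | "u > int n" | "i > int r" "0 < u" "u \<le> int n" | "0 < u" "u \<le> int n" "i \<le> int r"
    by linarith
  then show ?thesis
  proof cases
    case 1
    then show ?thesis using heightsD(4)[OF D, of u i] by (auto simp: upper_step_def)
  next
    case 2
    \<comment> \<open>Position 0 never reaches height 2, since its diagonal neighbour at position -1
      has height 0.\<close>
    then show ?thesis using heightsD(4)[OF D, of "-1" "i - 1"] heights_step(3)[OF D, of i 0]
      by (auto simp: upper_step_def)
  next
    case 3
    then show ?thesis using heightsD(5)[OF D, of u i] by (auto simp: upper_step_def)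
  next
    case 4
    then show ?thesis
      using heightsD(7)[OF D, of i u] entry_bounds(1)[OF mat_of_height_mats, of 1 u] by (auto simp: upper_step_def)
  next
    case 5
    then have "1 \<le> nat u" "nat u \<le> n" "1 \<le> nat (int r - i + 2)"
      by auto
    from le_mat_of_height_1[OF this]
    have "int r - i + 2 \<le> int (mat_of_height D (1, nat u)) \<longleftrightarrow> D i u \<ge> 2"
      using 5 by (simp add: nat_le_iff)
    with 5 show ?thesis
      unfolding upper_step_def by linarith
  qed
qed

lemma lower_step_mat_of_height: "lower_step (mat_of_height D) i u \<longleftrightarrow> D i u \<ge> 1"
proof -
  consider "u < 0" | "u > int n" | "u = int n" | "i > int r" "0 \<le> u" "u < int n" | "0 \<le> u" "u < int n" "i \<le> int r"
    by linarith
  then show ?thesis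
  proof cases
    case 1
    then show ?thesis using heightsD(4)[OF D, of u i] by (auto simp: lower_step_def)
  next
    case 2
    then show ?thesis using heightsD(5)[OF D, of u i] by (auto simp: lower_step_def)
  next
    case 3
    \<comment> \<open>Position n always has height at least 1, since its diagonal neighbour at
      position n + 1 has height 2.\<close>
    then show ?thesis
      using heightsD(5)[OF D, of "u + 1" "i + 1"] heightsD(3)[OF D, of i u]
      by (auto simp: lower_step_def)
  next
    case 4
    then show ?thesis
      using heightsD(7)[OF D, of i u] entry_bounds(1)[OF mat_of_height_mats, of 2 "u + 1"]
      by (auto simp: lower_step_def)
  next
    case 5
    then have "1 \<le> nat (u + 1)" "nat (u + 1) \<le> n" "1 \<le> nat (int r - i + 1)"
      by auto
    from le_mat_of_height_2[OF this]
    have "int r - i + 1 \<le> int (mat_of_height D (2, nat (u + 1))) \<longleftrightarrow> D i u \<ge> 1"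
      using 5 by (simp add: nat_le_iff)
    with 5 show ?thesis
      unfolding lower_step_def by linarith
  qed
qed

lemma height_of_mat_of_height: "height_of_mat (mat_of_height D) = D"
proof (intro ext)
  fix i u
  show "height_of_mat (mat_of_height D) i u = D i u"
    using heights_bounds[of i u]
    unfolding height_of_mat_def upper_step_mat_of_height lower_step_mat_of_height by auto
qed

end

lemma bij_height_of_mat: "bij_betw height_of_mat mats heights"
proof (rule bij_betw_imageI[OF inj_height_of_mat])
  show "height_of_mat ` mats = heights"
    using height_of_mat_heights mat_of_height_mats height_of_mat_of_height by (auto, metis imageI)
qed

end

theorem theorem1:
  fixes n k r :: nat
  assumes "n \<ge> 1" and "k \<ge> 2" and "r = k - 1"
  shows "(\<exists>f. bij_betw f (weakly_increasing_mats n k) (kekule_structures n r))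
         \<and> card (weakly_increasing_mats n k) = card (kekule_structures n r)"
proof -
  interpret hexagonal_benzenoid n r
    using assms by unfold_locales auto
  have "bij_betw (matching_of \<circ> height_of_mat) (weakly_increasing_mats n k) (kekule_structures n r)"
    using bij_betw_trans[OF bij_height_of_mat bij_matching_of] assms by simp
  then show ?thesis
    using bij_betw_same_card by blast
qed

end
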